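(* Let $k\in(0,1)$, $\rho_0>0$, $r_*>0$ and $\Delta\in(0,r_* )$, and let $(M^{(0)},V^{(0)},a^{(0)},b^{(0)})$ be the static solution of the spherically symmetric Einstein--Euler equations with linear equation of state $p=k^2\rho$ and central density $\rho_0$. Then there exist constants $C_1,C_2,C_3,C_4>0$ depending on $r_*$ and $\Delta$ (and on the fixed parameters $k,\rho_0$) such that for all $\delta\in(0,\Delta)$ and $h>0$ with $\frac{\delta}{h}\le\frac1{C_1}$, the $(r_*,\delta,h)$-perturbed initial data set $(M_0,V_0,a_0,b_0)$ satisfies: (1) $0<a_0(r)\le a^{(0)}(r)$ for all $r\ge 0$; (2) $\partial_v a_0(r)=0$ for $0\le r<r_*-\delta$; (3) $\partial_v a_0(r)<0$ for all $r>r_*-\delta$; (4) $\partial_v a_0(r)\le -C_2\frac{\delta}{h^3}$ for $r_*-\delta\le r\le r_*+\delta$; (5) $\partial_v a_0(r)\le -C_4\frac{1}{h^2}$ for $r_*-\delta\le r\le r_*+\delta$; (6) $\partial_v a_0(r)\le -C_3\frac{\delta}{h}$ for $r_*+\delta<r\le r_*+\Delta$. In particular, such an initial data set does not contain trapped surfaces (i.e. $a_0(r)>0$ for all $r\ge0$), and for suitably chosen $\delta,h$ the quantity $\partial_v a_0$ is very negative on $[r_*-\delta,r_*+\delta]$: for every $K>0$ there are $\delta\in(0,\Delta)$ and $h>0$ with $\frac{\delta}{h}\le\frac{1}{C_1}$ such that $\partial_v a_0(r)\le -K$ for all $r\in[r_*-\delta,r_*+\delta]$.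
   Context: Setting. Units are such that the Einstein equations read $G_{\mu\nu}=8\pi T_{\mu\nu}$, with perfect fluid energy-momentum tensor $T_{\mu\nu}=(\rho+p)u_\mu u_\nu+p\,g_{\mu\nu}$ and $p=k^2\rho$. Spherically symmetric metrics are written in generalized Eddington--Finkelstein coordinates $$\mathbf g=-a(v,r)b(v,r)^2dv^2+2b(v,r)\,dv\,dr+r^2(d\theta^2+\sin^2\theta\,d\varphi^2),$$ and the fluid is described by the normalized mass $M=b^2\rho\,u^0u^0$ and normalized velocity $V=\frac{u^1}{bu^0}-\frac a2$. A trapped surface is present at $(v,r)$ if $a(v,r)<0$; initial data at $v=v_0$ contain no trapped surfaces if $a(v_0,r)>0$ for all $r\ge0$. Static solution. Given $k\in(0,1)$ and central density $\rho_0>0$, let $(\rho^{(0)},m)$ be the solution on $[0,\infty)$, regular at the center, of $$m'(r)=4\pi r^2\rho^{(0)}(r),\qquad k^2(\rho^{(0)})'(r)=-\frac{(1+k^2)\rho^{(0)}(r)\,\bigl(m(r)+4\pi k^2r^3\rho^{(0)}(r)\bigr)}{r^2\left(1-\frac{2m(r)}{r}\right)},\qquad m(0)=0,\ \rho^{(0)}(0)=\rho_0$$ (it is a known fact that this solution exists globally, with $\rho^{(0)}>0$ and $1-2m/r>0$). The static solution is $$a^{(0)}(r)=1-\frac{2m(r)}r\ \ (a^{(0)}(0)=1),\qquad V^{(0)}=-\tfrac12a^{(0)},\qquad M^{(0)}=\frac{\rho^{(0)}}{a^{(0)}},\qquad b^{(0)}(r)=\left(\frac{\rho_0}{\rho^{(0)}(r)}\right)^{\frac{k^2}{1+k^2}}a^{(0)}(r)^{-1/2}.$$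 Perturbed data. For $r_*>0$, $\Delta\in(0,r_* )$, $\delta\in(0,\Delta)$, $h>0$, let $V^{(1)}(r)=\frac{V^{(0)}(r)}{h}$ for $r_*-\delta\le r\le r_*+\delta$ and $V^{(1)}(r)=0$ otherwise. The $(r_*,\delta,h)$-perturbed initial data $(M_0,V_0,a_0,b_0)$ are $$M_0=M^{(0)},\qquad V_0=V^{(0)}+V^{(1)},\qquad b_0=b^{(0)},$$ $$a_0(r)=1-\frac{4\pi(1+k^2)}r\int_0^r\frac{b_0(s)}{b_0(r)}M_0(s)\left(2\,\frac{1-k^2}{1+k^2}|V_0(s)|+1\right)s^2\,ds\quad(r>0),\qquad a_0(0)=1.$$ Notation $\partial_va_0$. $\partial_va_0(r)$ denotes the value $a_v(v_0,r)$ of the $v$-derivative of $a$ at the initial time $v_0$, as determined from the initial data by the Einstein equations, namely $$\partial_va_0(r)=2\pi(1+k^2)\,r\,b_0(r)M_0(r)\bigl(a_0(r)^2-4V_0(r)^2\bigr).$$ *)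

theory Defs
  imports "HOL-Analysis.Analysis"
begin

text \<open>
  Spherically symmetric perfect fluids with equation of state \<open>p = k\<^sup>2 \<rho>\<close> in generalized
  Eddington--Finkelstein coordinates with metric
  \<open>- a b\<^sup>2 dv\<^sup>2 + 2 b dv dr + r\<^sup>2 (d\<theta>\<^sup>2 + sin\<^sup>2 \<theta> d\<phi>\<^sup>2)\<close>.
  Data on a slice of constant \<open>v\<close> consist of the normalized mass, the normalized velocity
  and the metric coefficients \<open>a\<close> and \<open>b\<close>, as functions of the area radius; only their
  values at radii \<open>r \<ge> 0\<close> are meaningful.
\<close>

record fluid_data =
  Mfun :: "real \<Rightarrow> real"
  Vfun :: "real \<Rightarrow> real"
  afun :: "real \<Rightarrow> real"
  bfun :: "real \<Rightarrow> real"

text \<open>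
  Regularity at the center means that both functions extend continuously to \<open>r = 0\<close> with the
  prescribed values; the second equation is imposed for \<open>r > 0\<close> only, since its right-hand
  side is an expression \<open>0/0\<close> at the center. The last clause records the known positivity
  properties of the global solution, and in particular keeps all denominators nonzero.
\<close>

definition static_profile ::
  "real \<Rightarrow> real \<Rightarrow> (real \<Rightarrow> real) \<Rightarrow> (real \<Rightarrow> real) \<Rightarrow> bool" where
  "static_profile k \<rho>\<^sub>0 \<rho> m \<longleftrightarrow>
     continuous_on {0..} \<rho> \<and> \<rho> 0 = \<rho>\<^sub>0 \<and> m 0 = 0 \<and>
     (\<forall>r\<ge>0. (m has_real_derivative 4 * pi * r\<^sup>2 * \<rho> r) (at r within {0..})) \<and>
     (\<forall>r>0. ((\<lambda>s. k\<^sup>2 * \<rho> s) has_real_derivative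
        - ((1 + k\<^sup>2) * \<rho> r * (m r + 4 * pi * k\<^sup>2 * r ^ 3 * \<rho> r)) / (r\<^sup>2 * (1 - 2 * m r / r))) (at r)) \<and>
     (\<forall>r\<ge>0. \<rho> r > 0) \<and> (\<forall>r>0. 1 - 2 * m r / r > 0)"

definition a_static :: "(real \<Rightarrow> real) \<Rightarrow> real \<Rightarrow> real" where
  "a_static m r = (if r = 0 then 1 else 1 - 2 * m r / r)"

definition static_data ::
  "real \<Rightarrow> real \<Rightarrow> (real \<Rightarrow> real) \<Rightarrow> (real \<Rightarrow> real) \<Rightarrow> fluid_data" where
  "static_data k \<rho>\<^sub>0 \<rho> m =
     \<lparr> Mfun = (\<lambda>r. \<rho> r / a_static m r),
       Vfun = (\<lambda>r. - (1 / 2) * a_static m r),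
       afun = a_static m,
       bfun = (\<lambda>r. (\<rho>\<^sub>0 / \<rho> r) powr (k\<^sup>2 / (1 + k\<^sup>2)) * a_static m r powr (- 1 / 2)) \<rparr>"

definition velocity_bump :: "fluid_data \<Rightarrow> real \<Rightarrow> real \<Rightarrow> real \<Rightarrow> real \<Rightarrow> real" where
  "velocity_bump S rs \<delta> h r = (if rs - \<delta> \<le> r \<and> r \<le> rs + \<delta> then Vfun S r / h else 0)"

text \<open>
  The coefficient \<open>a\<close> of initial data is determined by the other three functions through the
  constraint equation on the initial slice.
\<close>

definition a_constraint ::
  "real \<Rightarrow> (real \<Rightarrow> real) \<Rightarrow> (real \<Rightarrow> real) \<Rightarrow> (real \<Rightarrow> real) \<Rightarrow> real \<Rightarrow> real" where
  "a_constraint k M V b r =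
     (if r = 0 then 1
      else 1 - 4 * pi * (1 + k\<^sup>2) / r *
        integral {0..r} (\<lambda>s. b s / b r * M s *
          (2 * ((1 - k\<^sup>2) / (1 + k\<^sup>2)) * \<bar>V s\<bar> + 1) * s\<^sup>2))"

definition perturbed_data ::
  "real \<Rightarrow> fluid_data \<Rightarrow> real \<Rightarrow> real \<Rightarrow> real \<Rightarrow> fluid_data" where
  "perturbed_data k S rs \<delta> h =
     (let V = (\<lambda>r. Vfun S r + velocity_bump S rs \<delta> h r)
      in \<lparr> Mfun = Mfun S, Vfun = V, afun = a_constraint k (Mfun S) V (bfun S), bfun = bfun S \<rparr>)"

text \<open>
  The value of \<open>\<partial>a/\<partial>v\<close> on the initial slice, expressed through the data by the Einstein
  equations.
\<close>

definition dv_a :: "real \<Rightarrow> fluid_data \<Rightarrow> real \<Rightarrow> real" where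
  "dv_a k D r =
     2 * pi * (1 + k\<^sup>2) * r * bfun D r * Mfun D r * ((afun D r)\<^sup>2 - 4 * (Vfun D r)\<^sup>2)"

definition no_trapped_surfaces :: "fluid_data \<Rightarrow> bool" where
  "no_trapped_surfaces D \<longleftrightarrow> (\<forall>r\<ge>0. afun D r > 0)"

end

theory Submission
  imports Defs
begin

text \<open>
  The static equations give \<open>b' / b = 4 \<pi> (1 + k\<^sup>2) r \<rho> / a\<close>, hence \<open>2 m b\<close> is a primitive of the
  unperturbed integrand of the constraint equation. Since the static velocity and the bump have the
  same sign, the constraint is additive in the bump, and \<open>a\<^sub>0 = a - 4 \<pi> (1 - k\<^sup>2) / (h r b) J\<close>, where \<open>J(r)\<close> is
  the integral of \<open>b \<rho> s\<^sup>2\<close> over the part of \<open>[rs - \<delta>, rs + \<delta>]\<close> below \<open>r\<close>; thus \<open>J\<close> is of order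
  \<open>\<delta>\<close> from \<open>rs + \<delta>\<close> on. All claims then follow from \<open>\<partial>\<^sub>v a\<^sub>0 \<propto> a\<^sub>0\<^sup>2 - a\<^sup>2 (1 + \<xi>)\<^sup>2\<close>, with
  \<open>\<xi> = 1 / h\<close> on the bump and \<open>0\<close> elsewhere.

  The constants must not depend on the profile. This rests on Buchdahl's inequality \<open>a \<ge> 1 / 9\<close>, which
  turns the equation for \<open>\<rho>\<close> into an explicit Gaussian lower bound on \<open>\<rho>\<close> and an upper bound on \<open>b\<close>.
\<close>

section \<open>The static solution: potential, metric coefficients and their derivatives\<close>

locale static_star =
  fixes k \<rho>\<^sub>0 :: real and \<rho> m :: "real \<Rightarrow> real"
  assumes k_pos: "0 < k" and k_less_1: "k < 1" and profile: "static_profile k \<rho>\<^sub>0 \<rho> m"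
begin

definition a :: "real \<Rightarrow> real" where "a = a_static m"

text \<open>The relativistic gravitational potential: \<open>exp (2 * \<phi> r)\<close> is the
  coefficient \<open>a * b\<^sup>2\<close> of the static metric, normalized to 1 at the
  center.\<close>

definition \<phi> :: "real \<Rightarrow> real" where "\<phi> r = k\<^sup>2 / (1 + k\<^sup>2) * (ln \<rho>\<^sub>0 - ln (\<rho> r))"

text \<open>Agrees with the \<open>powr\<close> expression in the static data for
  \<open>0 \<le> r\<close> (\<open>bfun_S\<close>); this form is easier to differentiate.\<close>

definition b :: "real \<Rightarrow> real" where "b r = exp (\<phi> r) / sqrt (a r)"

lemma rho_pos: "0 \<le> r \<Longrightarrow> 0 < \<rho> r"
  using profile by (simp add: static_profile_def)

lemma rho_0: "\<rho> 0 = \<rho>\<^sub>0"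
  using profile by (simp add: static_profile_def)

lemma m_0: "m 0 = 0"
  using profile by (simp add: static_profile_def)

lemma rho0_pos: "0 < \<rho>\<^sub>0"
  using rho_pos[of 0] rho_0 by simp

lemma a_0: "a 0 = 1"
  by (simp add: a_def a_static_def)

lemma a_eq: "r \<noteq> 0 \<Longrightarrow> a r = 1 - 2 * m r / r"
  by (simp add: a_def a_static_def)

lemma a_pos: "0 \<le> r \<Longrightarrow> 0 < a r"
  using profile by (cases "r = 0") (auto simp: static_profile_def a_0 a_eq)

lemma continuous_on_rho: "continuous_on {0..} \<rho>"
  using profile by (simp add: static_profile_def)

lemma m_deriv_within:
  "0 \<le> r \<Longrightarrow> (m has_real_derivative 4 * pi * r\<^sup>2 * \<rho> r) (at r within {0..})"
  using profile by (simp add: static_profile_def)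

lemma m_deriv:
  assumes "0 < r" shows "(m has_real_derivative 4 * pi * r\<^sup>2 * \<rho> r) (at r)"
proof -
  have "at r within {0..} = at r"
    by (rule at_within_interior) (use assms in \<open>simp\<close>)
  with m_deriv_within[of r] assms show ?thesis by (metis less_imp_le)
qed

lemma continuous_on_m: "continuous_on {0..} m"
  by (rule DERIV_continuous_on) (use m_deriv_within in auto)

lemma rho_deriv:
  assumes "0 < r"
  shows "(\<rho> has_real_derivative
    - ((1 + k\<^sup>2) / k\<^sup>2 * \<rho> r * ((m r + 4 * pi * k\<^sup>2 * r ^ 3 * \<rho> r) / (r\<^sup>2 * a r)))) (at r)"
proof -
  have "((\<lambda>s. k\<^sup>2 * \<rho> s) has_real_derivative
        - ((1 + k\<^sup>2) * \<rho> r * (m r + 4 * pi * k\<^sup>2 * r ^ 3 * \<rho> r)) / (r\<^sup>2 * a r)) (at r)"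
    using profile assms by (simp add: static_profile_def a_eq)
  then have "((\<lambda>s. 1 / k\<^sup>2 * (k\<^sup>2 * \<rho> s)) has_real_derivative
    - ((1 + k\<^sup>2) / k\<^sup>2 * \<rho> r * ((m r + 4 * pi * k\<^sup>2 * r ^ 3 * \<rho> r) / (r\<^sup>2 * a r)))) (at r)"
    by (rule DERIV_cong[OF DERIV_cmult]) simp
  moreover have "(\<lambda>s. 1 / k\<^sup>2 * (k\<^sup>2 * \<rho> s)) = \<rho>" using k_pos by simp
  ultimately show ?thesis by simp
qed

lemma a_deriv:
  assumes "0 < r"
  shows "(a has_real_derivative 2 * m r / r\<^sup>2 - 8 * pi * r * \<rho> r) (at r)"
proof -
  have "((\<lambda>s. 1 - 2 * m s / s) has_real_derivative 2 * m r / r\<^sup>2 - 8 * pi * r * \<rho> r) (at r)"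
    using assms by (auto intro!: derivative_eq_intros m_deriv simp: field_simps power2_eq_square)
  then show ?thesis
    by (rule has_field_derivative_transform_within_open[where S = "{0<..}"])
       (use assms in \<open>auto simp: a_eq\<close>)
qed

text \<open>The weight in \<open>\<phi>\<close> inverts the prefactor in the logarithmic derivative
  of \<open>\<rho>\<close>, so only the gravitational acceleration remains.\<close>

lemma phi_deriv:
  assumes "0 < r"
  shows "(\<phi> has_real_derivative (m r + 4 * pi * k\<^sup>2 * r ^ 3 * \<rho> r) / (r\<^sup>2 * a r)) (at r)"
proof -
  define A where "A = (m r + 4 * pi * k\<^sup>2 * r ^ 3 * \<rho> r) / (r\<^sup>2 * a r)"
  have "k\<^sup>2 / (1 + k\<^sup>2) * ((1 + k\<^sup>2) / k\<^sup>2) = 1"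
    using k_pos sum_squares_gt_zero_iff[of 1 k] by (simp add: power2_eq_square)
  moreover have "p * (0 - inverse x * - (q * x * A)) = A" if "p * q = 1" "x \<noteq> 0" for p q x
  proof -
    have "p * (0 - inverse x * - (q * x * A)) = (p * q) * (inverse x * x) * A" by simp
    then show ?thesis using that by simp
  qed
  moreover have "\<rho> r \<noteq> 0" using rho_pos[of r] assms by simp
  ultimately have eq:
    "k\<^sup>2 / (1 + k\<^sup>2) * (0 - inverse (\<rho> r) * - ((1 + k\<^sup>2) / k\<^sup>2 * \<rho> r * A)) = A"
    by blast
  have "(\<phi> has_real_derivative
      k\<^sup>2 / (1 + k\<^sup>2) * (0 - inverse (\<rho> r) * - ((1 + k\<^sup>2) / k\<^sup>2 * \<rho> r * A))) (at r)"
    unfolding \<phi>_def A_def using assms rho_pos[of r]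
    by (intro DERIV_cmult DERIV_diff DERIV_const DERIV_chain2[OF DERIV_ln] rho_deriv) auto
  then show ?thesis unfolding eq by (simp add: A_def)
qed

text \<open>The logarithmic derivative is \<open>\<phi>' - a' / (2 * a)\<close>. The mass terms of
  the two summands cancel; the density and pressure terms add up to the factor
  \<open>1 + k\<^sup>2\<close>.\<close>

lemma b_deriv:
  assumes "0 < r"
  shows "(b has_real_derivative b r * (4 * pi * (1 + k\<^sup>2) * r * \<rho> r / a r)) (at r)"
proof -
  define A where "A = (m r + 4 * pi * k\<^sup>2 * r ^ 3 * \<rho> r) / (r\<^sup>2 * a r)"
  define B where "B = 2 * m r / r\<^sup>2 - 8 * pi * r * \<rho> r"
  define q where "q = sqrt (a r)"
  have a: "0 < a r" using a_pos assms by simp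
  have q: "0 < q" "a r = q * q" using a by (auto simp: q_def)
  have eq: "A - B / (2 * a r) = 4 * pi * (1 + k\<^sup>2) * r * \<rho> r / a r"
    unfolding A_def B_def using a assms by (simp add: field_simps eval_nat_numeral)
  have "(b has_real_derivative
      (exp (\<phi> r) * A * sqrt (a r) - exp (\<phi> r) * (inverse (sqrt (a r)) / 2 * B))
        / (sqrt (a r) * sqrt (a r))) (at r)"
    unfolding b_def A_def B_def using a
    by (intro DERIV_divide DERIV_chain2[OF DERIV_exp] DERIV_chain2[OF DERIV_real_sqrt]
        phi_deriv a_deriv assms) auto
  also have "(exp (\<phi> r) * A * sqrt (a r) - exp (\<phi> r) * (inverse (sqrt (a r)) / 2 * B))
        / (sqrt (a r) * sqrt (a r)) = b r * (A - B / (2 * a r))"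
    unfolding b_def q_def[symmetric] q(2) using q(1) by (simp add: field_simps)
  finally show ?thesis by (simp only: eq)
qed

section \<open>Monotonicity of mass, density and mean density\<close>

lemma m_pos:
  assumes "0 < r" shows "0 < m r"
proof -
  have "m 0 < m r"
  proof (rule DERIV_pos_imp_increasing_open[OF assms])
    fix x assume "0 < x" "x < r"
    then show "\<exists>y. (m has_real_derivative y) (at x) \<and> 0 < y"
      by (intro exI[of _ "4 * pi * x\<^sup>2 * \<rho> x"]) (use rho_pos[of x] in \<open>auto intro: m_deriv\<close>)
  qed (auto intro: continuous_on_subset[OF continuous_on_m])
  then show ?thesis by (simp add: m_0)
qed

lemma rho_antimono:
  assumes "0 \<le> r" "r \<le> s" shows "\<rho> s \<le> \<rho> r"
proof (rule DERIV_nonpos_imp_decreasing_open[OF assms(2)])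
  fix x assume "r < x" "x < s"
  then have "0 < x" using assms by simp
  have "0 \<le> (1 + k\<^sup>2) / k\<^sup>2 * \<rho> x * ((m x + 4 * pi * k\<^sup>2 * x ^ 3 * \<rho> x) / (x\<^sup>2 * a x))"
    using \<open>0 < x\<close> rho_pos[of x] m_pos[of x] a_pos[of x] by simp
  then show "\<exists>y. (\<rho> has_real_derivative y) (at x) \<and> y \<le> 0"
    using rho_deriv[OF \<open>0 < x\<close>] by (metis neg_le_0_iff_le)
qed (use assms in \<open>auto intro: continuous_on_subset[OF continuous_on_rho]\<close>)

lemma rho_le: "0 \<le> r \<Longrightarrow> \<rho> r \<le> \<rho>\<^sub>0"
  using rho_antimono[of 0 r] by (simp add: rho_0)

text \<open>Since \<open>\<rho>\<close> decreases, the ball of radius \<open>R\<close> is at least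
  as heavy as a homogeneous one with its boundary density.\<close>

lemma m_lower:
  assumes "0 \<le> R" shows "4 / 3 * pi * R ^ 3 * \<rho> R \<le> m R"
proof -
  let ?f = "\<lambda>r. m r - 4 / 3 * pi * r ^ 3 * \<rho> R"
  have "?f 0 \<le> ?f R"
  proof (rule DERIV_nonneg_imp_increasing_open[OF assms])
    fix x assume "0 < x" "x < R"
    then have "(?f has_real_derivative 4 * pi * x\<^sup>2 * (\<rho> x - \<rho> R)) (at x)"
      by (auto intro!: derivative_eq_intros m_deriv simp: algebra_simps)
    moreover have "0 \<le> 4 * pi * x\<^sup>2 * (\<rho> x - \<rho> R)"
      using rho_antimono[of x R] \<open>0 < x\<close> \<open>x < R\<close> by simp
    ultimately show "\<exists>y. (?f has_real_derivative y) (at x) \<and> 0 \<le> y" by blast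
  qed (auto intro!: continuous_intros continuous_on_subset[OF continuous_on_m])
  then show ?thesis by (simp add: m_0)
qed

lemma m_upper:
  assumes "0 \<le> R" shows "m R \<le> 4 / 3 * pi * R ^ 3 * \<rho>\<^sub>0"
proof -
  let ?f = "\<lambda>r. 4 / 3 * pi * r ^ 3 * \<rho>\<^sub>0 - m r"
  have "?f 0 \<le> ?f R"
  proof (rule DERIV_nonneg_imp_increasing_open[OF assms])
    fix x assume "0 < x" "x < R"
    then have "(?f has_real_derivative 4 * pi * x\<^sup>2 * (\<rho>\<^sub>0 - \<rho> x)) (at x)"
      by (auto intro!: derivative_eq_intros m_deriv simp: algebra_simps)
    moreover have "0 \<le> 4 * pi * x\<^sup>2 * (\<rho>\<^sub>0 - \<rho> x)"
      using rho_le[of x] \<open>0 < x\<close> by simp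
    ultimately show "\<exists>y. (?f has_real_derivative y) (at x) \<and> 0 \<le> y" by blast
  qed (auto intro!: continuous_intros continuous_on_subset[OF continuous_on_m])
  then show ?thesis by (simp add: m_0)
qed

text \<open>The left-hand side is the derivative of \<open>m r / r ^ 3\<close> and, up to the factor
  \<open>b r\<close>, also that of the Buchdahl quantity \<open>w\<close>; its sign comes from
  \<open>m_lower\<close>.\<close>

lemma density_le_mean_density:
  assumes "0 < r" shows "4 * pi * \<rho> r / r - 3 * m r / r ^ 4 \<le> 0"
  using m_lower[of r] assms by (simp add: field_simps eval_nat_numeral)

lemma mean_density_antimono:
  assumes "0 < r" "r \<le> s" shows "m s / s ^ 3 \<le> m r / r ^ 3"
proof (rule DERIV_nonpos_imp_nonincreasing[OF assms(2)])
  fix x assume "r \<le> x" "x \<le> s"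
  then have x: "0 < x" using assms by simp
  have "((\<lambda>r. m r / r ^ 3) has_real_derivative (4 * pi * \<rho> x / x - 3 * m x / x ^ 4)) (at x)"
    using x by (auto intro!: derivative_eq_intros m_deriv simp: field_simps eval_nat_numeral)
  moreover have "4 * pi * \<rho> x / x - 3 * m x / x ^ 4 \<le> 0"
    by (rule density_le_mean_density) fact
  ultimately show "\<exists>y. ((\<lambda>r. m r / r ^ 3) has_real_derivative y) (at x) \<and> y \<le> 0" by blast
qed

section \<open>Buchdahl's inequality\<close>

lemma b_pos: "0 \<le> r \<Longrightarrow> 0 < b r"
  using a_pos[of r] by (simp add: b_def)

text \<open>Equals \<open>sqrt a * (exp \<phi>)' / r\<close>, the monotone quantity of Buchdahl's argument.\<close>

definition w :: "real \<Rightarrow> real" where "w r = b r * (m r / r ^ 3 + 4 * pi * k\<^sup>2 * \<rho> r)"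

text \<open>The terms from \<open>b'\<close> and \<open>\<rho>'\<close> cancel by hydrostatic
  equilibrium, which leaves \<open>b\<close> times the derivative of
  \<open>m r / r ^ 3\<close>.\<close>

lemma w_antimono:
  assumes "0 < r" "r \<le> s" shows "w s \<le> w r"
proof (rule DERIV_nonpos_imp_nonincreasing[OF assms(2)])
  fix x assume "r \<le> x" "x \<le> s"
  then have x: "0 < x" using assms by simp
  have "(w has_real_derivative b x * (4 * pi * \<rho> x / x - 3 * m x / x ^ 4)) (at x)"
    unfolding w_def using x k_pos a_pos[of x]
    by (auto intro!: derivative_eq_intros m_deriv b_deriv rho_deriv
        simp: field_simps eval_nat_numeral)
  moreover have "4 * pi * \<rho> x / x - 3 * m x / x ^ 4 \<le> 0"
    by (rule density_le_mean_density) fact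
  then have "b x * (4 * pi * \<rho> x / x - 3 * m x / x ^ 4) \<le> 0"
    using b_pos[of x] x by (intro mult_nonneg_nonpos) auto
  ultimately show "\<exists>y. (w has_real_derivative y) (at x) \<and> y \<le> 0" by blast
qed

lemma continuous_on_phi: "continuous_on {0..} \<phi>"
proof -
  have "\<rho> r \<noteq> 0" if "0 \<le> r" for r using rho_pos[OF that] by simp
  then show ?thesis
    unfolding \<phi>_def by (intro continuous_intros continuous_on_rho) auto
qed

lemma phi_0: "\<phi> 0 = 0"
  by (simp add: \<phi>_def rho_0)

lemma phi_nonneg: "0 \<le> r \<Longrightarrow> 0 \<le> \<phi> r"
  using rho_le[of r] rho_pos[of r] rho0_pos by (simp add: \<phi>_def)

text \<open>Comparison with the homogeneous ball of mass \<open>m R\<close> and radius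
  \<open>R\<close>, whose metric coefficient is \<open>1 - \<mu> * s\<^sup>2\<close>. The decay of
  the mean density and of \<open>w\<close> bounds \<open>(exp \<phi>)'\<close> from below by
  \<open>w R * s / sqrt (1 - \<mu> * s\<^sup>2)\<close>. Integration over \<open>[0, R]\<close> and
  \<open>exp (\<phi> R) = b R * sqrt (a R)\<close> then give an inequality for
  \<open>sqrt (a R)\<close> alone.\<close>

lemma sqrt_a_ge:
  assumes "0 \<le> R" shows "1 / 3 \<le> sqrt (a R)"
proof (cases "R = 0")
  case True
  then show ?thesis by (simp add: a_0)
next
  case False
  then have R: "0 < R" using assms by simp
  define \<mu> where "\<mu> = 2 * m R / R ^ 3"
  have \<mu>: "0 < \<mu>" using R m_pos by (simp add: \<mu>_def)
  have aR: "1 - \<mu> * R\<^sup>2 = a R" using R by (simp add: \<mu>_def a_eq eval_nat_numeral)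
  have a_le: "a s \<le> 1 - \<mu> * s\<^sup>2" if "0 < s" "s \<le> R" for s
  proof -
    have "2 * m R / R ^ 3 * s\<^sup>2 \<le> 2 * m s / s ^ 3 * s\<^sup>2"
      using mean_density_antimono[OF that] by (intro mult_right_mono) auto
    also have "\<dots> = 2 * m s / s" using that by (simp add: eval_nat_numeral)
    finally show ?thesis using that by (simp add: \<mu>_def a_eq)
  qed
  \<comment> \<open>The pressure term of \<open>w R\<close> is dropped; \<open>\<mu> / 2\<close> is
    \<open>m R / R ^ 3\<close>.\<close>
  have w: "b R * (\<mu> / 2) \<le> w R"
    unfolding w_def \<mu>_def using R b_pos[of R] rho_pos[of R] by (intro mult_left_mono) auto
  have w_pos: "0 < w R" using w b_pos[of R] \<mu> R by (intro less_le_trans[OF _ w]) auto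
  define u where "u = (\<lambda>s. exp (\<phi> s))"
  \<comment> \<open>\<open>- sqrt (1 - \<mu> * s\<^sup>2)\<close> is a primitive of
    \<open>\<mu> * s / sqrt (1 - \<mu> * s\<^sup>2)\<close>, so monotonicity of \<open>G\<close> is
    the integrated comparison.\<close>
  define G where "G = (\<lambda>s. \<mu> * u s + w R * sqrt (1 - \<mu> * s\<^sup>2))"
  have "G 0 \<le> G R"
  proof (rule DERIV_nonneg_imp_increasing_open[OF assms])
    fix s assume s: "0 < s" "s < R"
    define c where "c = 1 - \<mu> * s\<^sup>2"
    have as: "0 < a s" "a s \<le> c" using a_pos[of s] a_le[of s] s by (auto simp: c_def)
    have "((\<lambda>x. exp (\<phi> x)) has_real_derivative
        exp (\<phi> s) * ((m s + 4 * pi * k\<^sup>2 * s ^ 3 * \<rho> s) / (s\<^sup>2 * a s))) (at s)"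
      by (auto intro!: derivative_eq_intros phi_deriv s)
    also have "exp (\<phi> s) * ((m s + 4 * pi * k\<^sup>2 * s ^ 3 * \<rho> s) / (s\<^sup>2 * a s)) = s * w s / sqrt (a s)"
    proof -
      have "sqrt (a s) * sqrt (a s) = a s" using as by simp
      then show ?thesis
        using s as by (simp add: w_def b_def field_simps eval_nat_numeral)
    qed
    finally have "(u has_real_derivative s * w s / sqrt (a s)) (at s)" by (simp only: u_def)
    then have "(G has_real_derivative \<mu> * (s * w s / sqrt (a s)) - w R * (\<mu> * s / sqrt c)) (at s)"
      unfolding G_def using as s
      by (auto intro!: derivative_eq_intros simp: c_def[symmetric] field_simps)
    moreover have "w R * (\<mu> * s / sqrt c) \<le> \<mu> * (s * w s / sqrt (a s))"
    proof -
      have "w R * (\<mu> * s / sqrt c) \<le> w s * (\<mu> * s / sqrt (a s))"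
        using as s \<mu> w_antimono[of s R] w_pos
        by (intro mult_mono divide_left_mono) auto
      then show ?thesis by (simp add: ac_simps)
    qed
    ultimately show "\<exists>y. (G has_real_derivative y) (at s) \<and> 0 \<le> y" by force
  next
    show "continuous_on {0..R} G" unfolding G_def u_def
      by (auto intro!: continuous_intros continuous_on_subset[OF continuous_on_phi])
  qed
  then have "w R * (1 - sqrt (a R)) \<le> \<mu> * (exp (\<phi> R) - 1)"
    by (simp add: G_def u_def phi_0 aR algebra_simps)
  \<comment> \<open>Dropping \<open>exp (\<phi> 0) = 1\<close> makes both sides proportional to
    \<open>b R * \<mu>\<close>, which cancels at the end.\<close>
  also have "\<dots> \<le> \<mu> * exp (\<phi> R)" using \<mu> by simp
  also have "exp (\<phi> R) = b R * sqrt (a R)" using a_pos[of R] R by (simp add: b_def)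
  finally have *: "w R * (1 - sqrt (a R)) \<le> \<mu> * (b R * sqrt (a R))" .
  have "a R \<le> 1" using R m_pos[of R] by (simp add: a_eq)
  then have "b R * (\<mu> / 2) * (1 - sqrt (a R)) \<le> w R * (1 - sqrt (a R))"
    using w by (intro mult_right_mono) auto
  also note *
  finally have "(b R * \<mu>) * ((1 - sqrt (a R)) / 2) \<le> (b R * \<mu>) * sqrt (a R)"
    by (simp add: ac_simps)
  then have "(1 - sqrt (a R)) / 2 \<le> sqrt (a R)"
    using b_pos[of R] \<mu> R by (subst (asm) mult_le_cancel_left_pos) auto
  then show ?thesis by simp
qed

lemma a_ge: "0 \<le> R \<Longrightarrow> 1 / 9 \<le> a R"
  using power_mono[OF sqrt_a_ge, of R 2] a_pos[of R] by (simp add: power2_eq_square)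

section \<open>Bounds on density and metric coefficients that are uniform in the profile\<close>

lemma a_le_1: "0 \<le> r \<Longrightarrow> a r \<le> 1"
  using m_pos[of r] a_0 by (cases "r = 0") (auto simp: a_eq)

lemma b_ge_1:
  assumes "0 \<le> r" shows "1 \<le> b r"
proof -
  have "sqrt (a r) \<le> 1" "1 \<le> exp (\<phi> r)" "0 < sqrt (a r)"
    using assms a_le_1 a_pos phi_nonneg by auto
  then show ?thesis by (simp add: b_def order_trans[of _ 1])
qed

text \<open>
  The exponent comes from \<open>k\<^sup>2 / (1 + k\<^sup>2) * \<bar>\<rho>'\<bar> / \<rho> \<le> 72 \<pi> \<rho>\<^sub>0 r\<close>, using \<open>a \<ge> 1 / 9\<close> and
  \<open>m + 4 \<pi> k\<^sup>2 r\<^sup>3 \<rho> \<le> 8 \<pi> r\<^sup>3 \<rho>\<^sub>0\<close>.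
\<close>

lemma rho_ge:
  assumes "0 \<le> R" shows "\<rho>\<^sub>0 * exp (- (72 / k\<^sup>2 * pi * \<rho>\<^sub>0 * R\<^sup>2)) \<le> \<rho> R"
proof -
  define c where "c = 72 / k\<^sup>2 * pi * \<rho>\<^sub>0"
  have "\<rho> 0 * exp (c * 0\<^sup>2) \<le> \<rho> R * exp (c * R\<^sup>2)"
  proof (rule DERIV_nonneg_imp_increasing_open[OF assms, where f = "\<lambda>r. \<rho> r * exp (c * r\<^sup>2)"])
    fix x assume x: "0 < x" "x < R"
    define A where "A = (m x + 4 * pi * k\<^sup>2 * x ^ 3 * \<rho> x) / (x\<^sup>2 * a x)"
    have \<rho>': "(\<rho> has_real_derivative - ((1 + k\<^sup>2) / k\<^sup>2 * \<rho> x * A)) (at x)"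
      using rho_deriv x by (simp add: A_def)
    have k2: "0 < k\<^sup>2" "k\<^sup>2 \<le> 1" using k_pos k_less_1 by (auto simp: power_le_one)
    have "k\<^sup>2 * \<rho> x \<le> 1 * \<rho>\<^sub>0"
      using k2 rho_le[of x] rho_pos[of x] x by (intro mult_mono) auto
    then have "4 * pi * x ^ 3 * (k\<^sup>2 * \<rho> x) \<le> 4 * pi * x ^ 3 * \<rho>\<^sub>0"
      using x by (intro mult_left_mono) auto
    then have "4 * pi * k\<^sup>2 * x ^ 3 * \<rho> x \<le> 4 * pi * x ^ 3 * \<rho>\<^sub>0"
      by (simp only: ac_simps)
    moreover have "0 \<le> pi * x ^ 3 * \<rho>\<^sub>0"
      using x rho0_pos by simp
    ultimately have num: "m x + 4 * pi * k\<^sup>2 * x ^ 3 * \<rho> x \<le> 8 * pi * x ^ 3 * \<rho>\<^sub>0"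
      using m_upper[of x] x by linarith
    have "A \<le> 8 * pi * x ^ 3 * \<rho>\<^sub>0 / (x\<^sup>2 * (1 / 9))"
      unfolding A_def using num a_ge[of x] x rho0_pos
      by (intro frac_le mult_left_mono) auto
    also have "\<dots> = 72 * pi * x * \<rho>\<^sub>0" using x by (simp add: eval_nat_numeral)
    finally have A: "A \<le> 72 * pi * x * \<rho>\<^sub>0" .
    have "(1 + k\<^sup>2) / k\<^sup>2 * A \<le> 2 / k\<^sup>2 * (72 * pi * x * \<rho>\<^sub>0)"
      using A k2 x rho0_pos m_pos[of x] rho_pos[of x] a_pos[of x]
      by (intro mult_mono divide_right_mono) (auto simp: A_def)
    also have "\<dots> = 2 * c * x" by (simp add: c_def)
    finally have "0 \<le> 2 * c * x - (1 + k\<^sup>2) / k\<^sup>2 * A" by simp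
    then have "0 \<le> \<rho> x * exp (c * x\<^sup>2) * (2 * c * x - (1 + k\<^sup>2) / k\<^sup>2 * A)"
      using rho_pos[of x] x by simp
    moreover have "((\<lambda>r. \<rho> r * exp (c * r\<^sup>2)) has_real_derivative
        \<rho> x * exp (c * x\<^sup>2) * (2 * c * x - (1 + k\<^sup>2) / k\<^sup>2 * A)) (at x)"
      by (auto intro!: derivative_eq_intros \<rho>' simp: algebra_simps)
    ultimately show "\<exists>y. ((\<lambda>r. \<rho> r * exp (c * r\<^sup>2)) has_real_derivative y) (at x) \<and> 0 \<le> y"
      by blast
  qed (auto intro!: continuous_intros continuous_on_subset[OF continuous_on_rho])
  then show ?thesis by (simp add: rho_0 exp_minus field_simps c_def)
qed

text \<open>The weight in \<open>\<phi>\<close> is at most 1, so \<open>rho_ge\<close> controls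
  \<open>exp \<phi>\<close>; the factor 3 is Buchdahl's bound on
  \<open>1 / sqrt (a R)\<close>.\<close>

lemma b_le:
  assumes "0 \<le> R" shows "b R \<le> 3 * exp (72 / k\<^sup>2 * pi * \<rho>\<^sub>0 * R\<^sup>2)"
proof -
  define c where "c = 72 / k\<^sup>2 * pi * \<rho>\<^sub>0 * R\<^sup>2"
  have "ln (\<rho>\<^sub>0 * exp (- c)) \<le> ln (\<rho> R)"
    using rho_ge[OF assms] rho0_pos by (intro ln_mono) (auto simp: c_def)
  then have "ln \<rho>\<^sub>0 - ln (\<rho> R) \<le> c" using rho0_pos by (simp add: ln_mult)
  moreover have "0 \<le> ln \<rho>\<^sub>0 - ln (\<rho> R)"
    using rho_le[of R] rho_pos[of R] assms rho0_pos by simp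
  ultimately have "\<phi> R \<le> 1 * c"
    unfolding \<phi>_def by (intro mult_mono) (auto simp: field_simps add_pos_nonneg)
  then have "b R \<le> exp c / (1 / 3)"
    unfolding b_def using sqrt_a_ge[OF assms] by (intro frac_le) auto
  then show ?thesis by (simp add: c_def)
qed

section \<open>Continuity up to the center and the static constraint equation\<close>

lemma continuous_on_a: "continuous_on {0..} a"
proof (clarsimp simp: continuous_on_eq_continuous_within)
  fix r :: real assume "0 \<le> r"
  show "continuous (at r within {0..}) a"
  proof (cases "r = 0")
    case False
    then show ?thesis using DERIV_isCont[OF a_deriv[of r]] \<open>0 \<le> r\<close>
      by (auto intro: continuous_at_imp_continuous_at_within)
  next
    case True
    \<comment> \<open>At the center \<open>a_deriv\<close> does not apply; instead
      \<open>m_upper\<close> squeezes \<open>a\<close> between a parabola and 1.\<close>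
    have "((\<lambda>r. 1 - 8 / 3 * pi * \<rho>\<^sub>0 * r\<^sup>2) \<longlongrightarrow> 1 - 8 / 3 * pi * \<rho>\<^sub>0 * 0\<^sup>2) (at 0 within {0..})"
      by (intro tendsto_intros)
    then have lim: "((\<lambda>r. 1 - 8 / 3 * pi * \<rho>\<^sub>0 * r\<^sup>2) \<longlongrightarrow> 1) (at 0 within {0..})" by simp
    have "1 - 8 / 3 * pi * \<rho>\<^sub>0 * r\<^sup>2 \<le> a r" if "0 < r" for r
      using m_upper[of r] that by (simp add: a_eq field_simps eval_nat_numeral)
    then have ev: "\<forall>\<^sub>F r in at 0 within {0..}. 1 - 8 / 3 * pi * \<rho>\<^sub>0 * r\<^sup>2 \<le> a r"
      by (auto simp: eventually_at_filter)
    have "\<forall>\<^sub>F r in at 0 within {0..}. a r \<le> 1"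
      using a_le_1 by (auto simp: eventually_at_filter)
    from tendsto_sandwich[OF ev this lim tendsto_const] show ?thesis
      by (simp add: True continuous_within a_0)
  qed
qed

lemma continuous_on_b: "continuous_on {0..} b"
  unfolding b_def using a_pos
  by (auto intro!: continuous_intros continuous_on_phi continuous_on_a
      simp: less_imp_neq[symmetric])

text \<open>With \<open>V = - a / 2\<close> this is the static constraint integrand multiplied by
  \<open>4 * pi * (1 + k\<^sup>2) * b R\<close>, so the static \<open>a\<close> solves its own
  constraint equation.\<close>

lemma static_constraint:
  assumes "0 \<le> R"
  shows "((\<lambda>s. 4 * pi * (b s * (\<rho> s / a s) * ((1 - k\<^sup>2) * a s + (1 + k\<^sup>2)) * s\<^sup>2))
    has_integral 2 * m R * b R) {0..R}"
proof -
  have "((\<lambda>s. 4 * pi * (b s * (\<rho> s / a s) * ((1 - k\<^sup>2) * a s + (1 + k\<^sup>2)) * s\<^sup>2))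
    has_integral 2 * m R * b R - 2 * m 0 * b 0) {0..R}"
  proof (rule fundamental_theorem_of_calculus_interior[OF assms])
    fix x assume "x \<in> {0<..<R}"
    then have x: "0 < x" by simp
    \<comment> \<open>Eliminating the mass turns the equality of the two integrands into an identity
      rational in \<open>a x\<close>.\<close>
    have mx: "2 * m x = x * (1 - a x)" using x by (simp add: a_eq)
    have "((\<lambda>r. 2 * m r * b r) has_real_derivative
       2 * (4 * pi * x\<^sup>2 * \<rho> x) * b x + 2 * m x * (b x * (4 * pi * (1 + k\<^sup>2) * x * \<rho> x / a x))) (at x)"
      using x by (auto intro!: derivative_eq_intros m_deriv b_deriv)
    also have "2 * (4 * pi * x\<^sup>2 * \<rho> x) * b x + 2 * m x * (b x * (4 * pi * (1 + k\<^sup>2) * x * \<rho> x / a x))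
      = 4 * pi * (b x * (\<rho> x / a x) * ((1 - k\<^sup>2) * a x + (1 + k\<^sup>2)) * x\<^sup>2)"
      unfolding mx using a_pos[of x] x by (simp add: field_simps eval_nat_numeral)
    finally show "((\<lambda>r. 2 * m r * b r) has_vector_derivative
      4 * pi * (b x * (\<rho> x / a x) * ((1 - k\<^sup>2) * a x + (1 + k\<^sup>2)) * x\<^sup>2)) (at x)"
      by (simp add: has_real_derivative_iff_has_vector_derivative)
  qed (auto intro!: continuous_intros continuous_on_subset[OF continuous_on_m]
        continuous_on_subset[OF continuous_on_b])
  then show ?thesis by (simp add: m_0)
qed

section \<open>The components of the static data\<close>

abbreviation S :: fluid_data where "S \<equiv> static_data k \<rho>\<^sub>0 \<rho> m"

lemma afun_S: "afun S = a"
  by (simp add: static_data_def a_def)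

lemma Mfun_S: "Mfun S r = \<rho> r / a r"
  by (simp add: static_data_def a_def)

lemma Vfun_S: "Vfun S r = - a r / 2"
  by (simp add: static_data_def a_def)

lemma bfun_S:
  assumes "0 \<le> r" shows "bfun S r = b r"
proof -
  have "(\<rho>\<^sub>0 / \<rho> r) powr (k\<^sup>2 / (1 + k\<^sup>2)) = exp (\<phi> r)"
    using rho_pos[OF assms] rho0_pos by (simp add: powr_def \<phi>_def ln_div)
  moreover have "a r powr (- 1 / 2) = inverse (sqrt (a r))"
    using powr_half_sqrt[of "a r"] a_pos[OF assms] powr_minus[of "a r" "1 / 2"] by simp
  moreover have
    "bfun S r = (\<rho>\<^sub>0 / \<rho> r) powr (k\<^sup>2 / (1 + k\<^sup>2)) * a r powr (- 1 / 2)"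
    by (simp add: static_data_def a_def)
  ultimately show ?thesis by (simp only: b_def divide_inverse)
qed

end

text \<open>The exponential factor of \<open>rho_ge\<close> and \<open>b_le\<close>. It does not
  involve \<open>\<rho>\<close> or \<open>m\<close>, so it can enter the constants before a profile
  is fixed.\<close>

definition growth :: "real \<Rightarrow> real \<Rightarrow> real \<Rightarrow> real" where
  "growth k \<rho>\<^sub>0 R = exp (72 / k\<^sup>2 * pi * \<rho>\<^sub>0 * R\<^sup>2)"

lemma growth_pos: "0 < growth k \<rho>\<^sub>0 R"
  by (simp add: growth_def)

section \<open>The perturbed data and their constraint equation\<close>

locale perturbed_star = static_star +
  fixes rs \<Delta> \<delta> h :: real
  assumes \<delta>_pos: "0 < \<delta>" and \<delta>_less: "\<delta> < \<Delta>" and \<Delta>_less: "\<Delta> < rs" and h_pos: "0 < h"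
begin

abbreviation D :: fluid_data where "D \<equiv> perturbed_data k S rs \<delta> h"

text \<open>The radius \<open>2 * rs\<close> exceeds \<open>rs + \<Delta>\<close>, hence every
  radius at which \<open>\<rho>\<close> or \<open>b\<close> is estimated by this factor.\<close>

abbreviation E :: real where "E \<equiv> growth k \<rho>\<^sub>0 (2 * rs)"

text \<open>The product of the static \<open>M\<close> and \<open>a\<close> is
  \<open>\<rho>\<close>, so \<open>a\<close> drops out of the bump's contribution. Below
  \<open>rs - \<delta>\<close> the interval is empty and the integral is 0; beyond the bump
  \<open>min\<close> freezes the value.\<close>

definition J :: "real \<Rightarrow> real" where
  "J r = integral {rs - \<delta>..min r (rs + \<delta>)} (\<lambda>s. b s * \<rho> s * s\<^sup>2)"

lemma J_integrable: "(\<lambda>s. b s * \<rho> s * s\<^sup>2) integrable_on {rs - \<delta>..u}"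
  by (intro integrable_continuous_real continuous_intros continuous_on_subset[OF continuous_on_b]
      continuous_on_subset[OF continuous_on_rho]) (use \<delta>_less \<Delta>_less in auto)

lemma bump_has_integral:
  "((\<lambda>s. if s \<in> {rs - \<delta>..rs + \<delta>} then b s * \<rho> s * s\<^sup>2 else 0) has_integral J r) {0..r}"
proof -
  have "{rs - \<delta>..rs + \<delta>} \<inter> {0..r} = {rs - \<delta>..min r (rs + \<delta>)}"
    using \<delta>_less \<Delta>_less by auto
  then show ?thesis
    unfolding has_integral_restrict_Int J_def by (simp only: integrable_integral[OF J_integrable])
qed

lemma D_simps:
  "Mfun D = Mfun S" "bfun D = bfun S" "afun D = a_constraint k (Mfun S) (Vfun D) (bfun S)"
  "Vfun D r = Vfun S r + velocity_bump S rs \<delta> h r"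
  by (simp_all add: perturbed_data_def Let_def)

lemma Vfun_D: "Vfun D r = - a r / 2 * (1 + (if r \<in> {rs - \<delta>..rs + \<delta>} then 1 / h else 0))"
  by (simp add: D_simps velocity_bump_def Vfun_S algebra_simps)

lemma afun_D:
  assumes "0 < r"
  shows "afun D r = a r - 4 * pi * (1 - k\<^sup>2) / (h * (r * b r)) * J r"
proof -
  define p where "p = 1 + k\<^sup>2"
  have p: "0 < p" by (simp add: p_def add_pos_nonneg)
  define f where "f = (\<lambda>s. 4 * pi * (b s * (\<rho> s / a s) * ((1 - k\<^sup>2) * a s + (1 + k\<^sup>2)) * s\<^sup>2))"
  define g where "g = (\<lambda>s. if s \<in> {rs - \<delta>..rs + \<delta>} then b s * \<rho> s * s\<^sup>2 else 0)"
  have br: "0 < b r" using b_pos assms by simp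
  \<comment> \<open>The weights scale the static and the bump integrand so that their sum is the
    integrand of the constraint.\<close>
  have "((\<lambda>s. 1 / (4 * pi * p * b r) * f s + (1 - k\<^sup>2) / (p * h * b r) * g s) has_integral
      1 / (4 * pi * p * b r) * (2 * m r * b r) + (1 - k\<^sup>2) / (p * h * b r) * J r) {0..r}"
    unfolding f_def g_def using assms
    by (intro has_integral_add has_integral_mult_right static_constraint bump_has_integral) auto
  moreover have "1 / (4 * pi * p * b r) * f s + (1 - k\<^sup>2) / (p * h * b r) * g s =
      bfun S s / bfun S r * Mfun S s * (2 * ((1 - k\<^sup>2) / (1 + k\<^sup>2)) * \<bar>Vfun D s\<bar> + 1) * s\<^sup>2"
    if "s \<in> {0..r}" for s
  proof -
    have as: "0 < a s" using a_pos that by simp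
    \<comment> \<open>Handles radii on and off the bump together: \<open>h * \<xi>\<close> is the
      indicator of the bump interval.\<close>
    define \<xi> where "\<xi> = (if s \<in> {rs - \<delta>..rs + \<delta>} then 1 / h else 0)"
    have "0 \<le> \<xi>" using h_pos by (simp add: \<xi>_def)
    then have V: "\<bar>Vfun D s\<bar> = a s / 2 * (1 + \<xi>)"
      unfolding Vfun_D \<xi>_def[symmetric] using as by (simp add: abs_mult)
    have g: "g s = h * \<xi> * (b s * \<rho> s * s\<^sup>2)" using h_pos by (simp add: g_def \<xi>_def)
    define q where "q = 1 - k\<^sup>2"
    show ?thesis
      unfolding V g f_def using that assms br as h_pos p
      by (simp add: bfun_S Mfun_S p_def[symmetric] q_def[symmetric] field_simps)
  qed
  ultimately have "((\<lambda>s. bfun S s / bfun S r * Mfun S s *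
      (2 * ((1 - k\<^sup>2) / (1 + k\<^sup>2)) * \<bar>Vfun D s\<bar> + 1) * s\<^sup>2) has_integral
      1 / (4 * pi * p * b r) * (2 * m r * b r) + (1 - k\<^sup>2) / (p * h * b r) * J r) {0..r}"
    by (rule has_integral_eq[rotated])
  then have "integral {0..r} (\<lambda>s. bfun S s / bfun S r * Mfun S s *
      (2 * ((1 - k\<^sup>2) / (1 + k\<^sup>2)) * \<bar>Vfun D s\<bar> + 1) * s\<^sup>2) =
      1 / (4 * pi * p * b r) * (2 * m r * b r) + (1 - k\<^sup>2) / (p * h * b r) * J r"
    by (rule integral_unique)
  moreover have "afun D r = a_constraint k (Mfun S) (Vfun D) (bfun S) r"
    by (simp only: D_simps)
  ultimately have "afun D r = 1 - 4 * pi * p / r *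
      (1 / (4 * pi * p * b r) * (2 * m r * b r) + (1 - k\<^sup>2) / (p * h * b r) * J r)"
    using assms by (simp add: a_constraint_def p_def)
  also have "\<dots> = (1 - 2 * m r / r) - 4 * pi * (1 - k\<^sup>2) / (h * (r * b r)) * J r"
    using assms br h_pos p by (simp add: divide_simps) (simp add: algebra_simps)
  finally show ?thesis using assms by (simp add: a_eq)
qed

lemma afun_D_0: "afun D 0 = 1"
  by (simp add: D_simps a_constraint_def)

lemma dv_a_D:
  assumes "0 \<le> r"
  shows "dv_a k D r = 2 * pi * (1 + k\<^sup>2) * (r * b r * (\<rho> r / a r)) *
    ((afun D r)\<^sup>2 - (a r * (1 + (if r \<in> {rs - \<delta>..rs + \<delta>} then 1 / h else 0)))\<^sup>2)"
proof -
  have "4 * (Vfun D r)\<^sup>2 = (a r * (1 + (if r \<in> {rs - \<delta>..rs + \<delta>} then 1 / h else 0)))\<^sup>2"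
    by (simp only: Vfun_D power_mult_distrib power_divide power2_minus) simp
  moreover have "bfun D r = b r" "Mfun D r = \<rho> r / a r"
    using bfun_S[OF assms] Mfun_S[of r] by (simp_all add: D_simps)
  ultimately show ?thesis by (simp add: dv_a_def ac_simps)
qed

section \<open>Two-sided bounds on the bump integral\<close>

lemma exponent_mono:
  assumes "0 \<le> r" "r \<le> 2 * rs"
  shows "exp (72 / k\<^sup>2 * pi * \<rho>\<^sub>0 * r\<^sup>2) \<le> E"
proof -
  have "72 / k\<^sup>2 * pi * \<rho>\<^sub>0 * r\<^sup>2 \<le> 72 / k\<^sup>2 * pi * \<rho>\<^sub>0 * (2 * rs)\<^sup>2"
    using assms rho0_pos by (intro mult_left_mono power_mono) auto
  then show ?thesis by (simp only: growth_def exp_le_cancel_iff)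
qed

lemma rho_ge_growth:
  assumes "0 \<le> r" "r \<le> 2 * rs" shows "\<rho>\<^sub>0 / E \<le> \<rho> r"
proof -
  have "\<rho>\<^sub>0 / E \<le> \<rho>\<^sub>0 / exp (72 / k\<^sup>2 * pi * \<rho>\<^sub>0 * r\<^sup>2)"
    using exponent_mono[OF assms] rho0_pos by (intro divide_left_mono) (auto simp: growth_pos)
  also have "\<dots> \<le> \<rho> r" using rho_ge[OF assms(1)] by (simp add: exp_minus field_simps)
  finally show ?thesis .
qed

lemma J_integrand_ge:
  assumes "rs - \<delta> \<le> s" "s \<le> rs + \<delta>"
  shows "\<rho>\<^sub>0 / E * (rs - \<Delta>)\<^sup>2 \<le> b s * \<rho> s * s\<^sup>2"
proof -
  have s: "0 \<le> s" "s \<le> 2 * rs" "rs - \<Delta> \<le> s" using assms \<delta>_less \<Delta>_less by auto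
  have "1 * (\<rho>\<^sub>0 / E) * (rs - \<Delta>)\<^sup>2 \<le> b s * \<rho> s * s\<^sup>2"
    using s b_ge_1[of s] rho_ge_growth[of s] rho0_pos rho_pos[of s]
      growth_pos[of k \<rho>\<^sub>0 "2 * rs"] \<Delta>_less
    by (intro mult_mono power_mono) auto
  then show ?thesis by simp
qed

text \<open>Here \<open>12 = 3 * 2\<^sup>2\<close>, from \<open>b s \<le> 3 * E\<close> and
  \<open>s \<le> 2 * rs\<close>.\<close>

lemma J_integrand_le:
  assumes "rs - \<delta> \<le> s" "s \<le> rs + \<delta>"
  shows "b s * \<rho> s * s\<^sup>2 \<le> 12 * E * \<rho>\<^sub>0 * rs\<^sup>2"
proof -
  have s: "0 \<le> s" "s \<le> 2 * rs" using assms \<delta>_less \<Delta>_less by auto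
  have "b s * \<rho> s * s\<^sup>2 \<le> 3 * E * \<rho>\<^sub>0 * (2 * rs)\<^sup>2"
    using s b_le[of s] exponent_mono[of s] rho_le[of s] rho_pos[of s] b_pos[of s] growth_pos
    by (intro mult_mono power_mono) auto
  then show ?thesis by (simp add: power_mult_distrib)
qed

lemma J_ge:
  assumes "rs - \<delta> \<le> r"
  shows "(min r (rs + \<delta>) - (rs - \<delta>)) * (\<rho>\<^sub>0 / E * (rs - \<Delta>)\<^sup>2) \<le> J r"
proof -
  have "integral {rs - \<delta>..min r (rs + \<delta>)} (\<lambda>s. \<rho>\<^sub>0 / E * (rs - \<Delta>)\<^sup>2) \<le> J r"
    unfolding J_def using J_integrand_ge by (intro integral_le J_integrable) auto
  also have "integral {rs - \<delta>..min r (rs + \<delta>)} (\<lambda>s. \<rho>\<^sub>0 / E * (rs - \<Delta>)\<^sup>2) =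
      (min r (rs + \<delta>) - (rs - \<delta>)) * (\<rho>\<^sub>0 / E * (rs - \<Delta>)\<^sup>2)"
    using assms \<delta>_pos by simp
  finally show ?thesis .
qed

lemma J_le:
  assumes "rs - \<delta> \<le> r" shows "J r \<le> 2 * \<delta> * (12 * E * \<rho>\<^sub>0 * rs\<^sup>2)"
proof -
  have "J r \<le> integral {rs - \<delta>..min r (rs + \<delta>)} (\<lambda>s. 12 * E * \<rho>\<^sub>0 * rs\<^sup>2)"
    unfolding J_def using J_integrand_le by (intro integral_le J_integrable) auto
  also have "\<dots> = (min r (rs + \<delta>) - (rs - \<delta>)) * (12 * E * \<rho>\<^sub>0 * rs\<^sup>2)"
    using assms \<delta>_pos by simp
  also have "\<dots> \<le> 2 * \<delta> * (12 * E * \<rho>\<^sub>0 * rs\<^sup>2)"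
    using rho0_pos growth_pos[of k \<rho>\<^sub>0 "2 * rs"] by (intro mult_right_mono) auto
  finally show ?thesis .
qed

lemma J_eq_0: "r < rs - \<delta> \<Longrightarrow> J r = 0"
  by (simp add: J_def)

lemma J_nonneg: "0 \<le> J r"
proof (cases "rs - \<delta> \<le> r")
  case True
  have "0 \<le> (min r (rs + \<delta>) - (rs - \<delta>)) * (\<rho>\<^sub>0 / E * (rs - \<Delta>)\<^sup>2)"
    using True \<delta>_pos rho0_pos growth_pos[of k \<rho>\<^sub>0 "2 * rs"] by simp
  then show ?thesis using J_ge[OF True] by simp
qed (simp add: J_eq_0)

lemma J_pos:
  assumes "rs - \<delta> < r" shows "0 < J r"
proof -
  have "0 < (min r (rs + \<delta>) - (rs - \<delta>)) * (\<rho>\<^sub>0 / E * (rs - \<Delta>)\<^sup>2)"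
    using assms \<delta>_pos \<Delta>_less rho0_pos growth_pos[of k \<rho>\<^sub>0 "2 * rs"] by simp
  then show ?thesis using J_ge[of r] assms by simp
qed

section \<open>Comparison of the perturbed coefficient with the static one, and its
  positivity\<close>

lemma coeff_pos: "0 < r \<Longrightarrow> 0 < 4 * pi * (1 - k\<^sup>2) / (h * (r * b r))"
  using h_pos k_pos k_less_1 b_pos[of r] by (simp add: power_less_one_iff)

lemma afun_D_le:
  assumes "0 \<le> r" shows "afun D r \<le> a r"
proof (cases "r = 0")
  case False
  then have "0 \<le> 4 * pi * (1 - k\<^sup>2) / (h * (r * b r)) * J r"
    using assms by (intro mult_nonneg_nonneg J_nonneg less_imp_le coeff_pos) auto
  then show ?thesis using assms False afun_D[of r] by linarith
qed (simp add: afun_D_0 a_0)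

lemma afun_D_less:
  assumes "rs - \<delta> < r" shows "afun D r < a r"
proof -
  have "0 < r" using assms \<delta>_less \<Delta>_less by simp
  then show ?thesis
    using mult_pos_pos[OF coeff_pos[of r] J_pos[OF assms]] afun_D[of r] by linarith
qed

text \<open>From the bump outward, \<open>J\<close> is bounded by its full-width estimate and
  \<open>r * b r \<ge> rs - \<Delta>\<close>, so the loss against \<open>a\<close> stays below
  Buchdahl's \<open>1 / 9\<close> at every radius. The constant is
  \<open>864 = 9 * 4 * 2 * 12\<close>: the 9 of Buchdahl, the coefficient \<open>4 * pi\<close>, the
  bump width \<open>2 * \<delta>\<close> and the 12 of \<open>J_integrand_le\<close>.\<close>

lemma afun_D_pos:
  assumes "0 \<le> r" and small: "\<delta> / h * (864 * pi * E * \<rho>\<^sub>0 * rs\<^sup>2 / (rs - \<Delta>)) < 1"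
  shows "0 < afun D r"
proof (cases "rs - \<delta> \<le> r")
  case False
  then show ?thesis
    using assms a_pos[of r] by (cases "r = 0") (auto simp: afun_D_0 afun_D J_eq_0)
next
  case True
  then have r: "0 < r" "rs - \<Delta> \<le> r" using \<delta>_less \<Delta>_less by auto
  have k: "0 \<le> 1 - k\<^sup>2" using k_pos k_less_1 by (simp add: power_le_one)
  have "(rs - \<Delta>) * 1 \<le> r * b r"
    using r b_ge_1[of r] \<Delta>_less by (intro mult_mono) auto
  then have "4 * pi * (1 - k\<^sup>2) / (h * (r * b r)) \<le> 4 * pi * 1 / (h * (rs - \<Delta>))"
    using h_pos \<Delta>_less k by (intro frac_le mult_left_mono) auto
  then have "4 * pi * (1 - k\<^sup>2) / (h * (r * b r)) * J r \<le>
      4 * pi * 1 / (h * (rs - \<Delta>)) * (2 * \<delta> * (12 * E * \<rho>\<^sub>0 * rs\<^sup>2))"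
    using J_le[OF True] J_nonneg[of r] h_pos \<Delta>_less by (intro mult_mono) auto
  also have "\<dots> = \<delta> / h * (864 * pi * E * \<rho>\<^sub>0 * rs\<^sup>2 / (rs - \<Delta>)) / 9" by simp
  also have "\<dots> < 1 / 9" using small by (rule divide_strict_right_mono) simp
  also have "\<dots> \<le> a r" using a_ge r by simp
  finally show ?thesis using r by (simp add: afun_D)
qed

section \<open>Sign and size of the initial \<open>v\<close>-derivative of the metric
  coefficient\<close>

lemma dv_a_D_eq_0:
  assumes "0 \<le> r" "r < rs - \<delta>" shows "dv_a k D r = 0"
  using assms by (cases "r = 0") (auto simp: dv_a_D afun_D J_eq_0)

text \<open>As \<open>afun D r \<le> a r\<close>, the expansion of
  \<open>(a r * (1 + 1 / h))\<^sup>2\<close> leaves at least its \<open>1 / h\<^sup>2\<close> term.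
  One power of \<open>a\<close> survives the division in \<open>M = \<rho> / a\<close> and is
  bounded below by \<open>1 / 9\<close>.\<close>

lemma dv_a_D_le_bump:
  assumes "rs - \<delta> \<le> r" "r \<le> rs + \<delta>" and pos: "0 < afun D r"
  shows "dv_a k D r \<le> - (2 / 9 * pi * (rs - \<Delta>) * (\<rho>\<^sub>0 / E)) * (1 / h\<^sup>2)"
proof -
  have r: "0 < r" "rs - \<Delta> \<le> r" "r \<le> 2 * rs" using assms \<delta>_less \<Delta>_less by auto
  have ar: "0 < a r" using a_pos r by simp
  have "1 * ((rs - \<Delta>) * 1 * (\<rho>\<^sub>0 / E)) * (1 / 9) \<le> (1 + k\<^sup>2) * (r * b r * \<rho> r) * a r"
    using r \<Delta>_less b_ge_1[of r] rho_ge_growth[of r] rho_pos[of r] a_ge[of r] rho0_pos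
      growth_pos[of k \<rho>\<^sub>0 "2 * rs"]
    by (intro mult_mono mult_nonneg_nonneg add_nonneg_nonneg) auto
  then have "2 * pi * (1 * ((rs - \<Delta>) * 1 * (\<rho>\<^sub>0 / E)) * (1 / 9)) * (1 / h\<^sup>2) \<le>
      2 * pi * ((1 + k\<^sup>2) * (r * b r * \<rho> r) * a r) * (1 / h\<^sup>2)"
    by (intro mult_right_mono mult_left_mono) auto
  also have "\<dots> = 2 * pi * (1 + k\<^sup>2) * (r * b r * (\<rho> r / a r)) * ((a r)\<^sup>2 * (1 / h\<^sup>2))"
    using ar by (simp add: power2_eq_square)
  also have "\<dots> \<le> 2 * pi * (1 + k\<^sup>2) * (r * b r * (\<rho> r / a r)) *
      ((a r * (1 + 1 / h))\<^sup>2 - (afun D r)\<^sup>2)"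
  proof (intro mult_left_mono)
    have "(afun D r)\<^sup>2 \<le> (a r)\<^sup>2" using pos afun_D_le[of r] r by (intro power_mono) auto
    moreover have "(a r * (1 + 1 / h))\<^sup>2 = (a r)\<^sup>2 + (a r)\<^sup>2 * (1 / h\<^sup>2) + 2 * ((a r)\<^sup>2 / h)"
      using h_pos by (simp add: power2_eq_square field_simps)
    moreover have "0 \<le> (a r)\<^sup>2 / h" using h_pos by simp
    ultimately show "(a r)\<^sup>2 * (1 / h\<^sup>2) \<le> (a r * (1 + 1 / h))\<^sup>2 - (afun D r)\<^sup>2" by linarith
    show "0 \<le> 2 * pi * (1 + k\<^sup>2) * (r * b r * (\<rho> r / a r))"
      using r ar b_pos[of r] rho_pos[of r] by simp
  qed
  also have "\<dots> = - dv_a k D r"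
    using r assms by (simp add: dv_a_D algebra_simps)
  finally show ?thesis by simp
qed

text \<open>The difference of squares is factored and \<open>a r + afun D r\<close> is bounded below
  by \<open>a r\<close>. The factors \<open>r * b r\<close> and \<open>a r\<close> then cancel,
  leaving \<open>\<rho> r * J r\<close>.\<close>

lemma dv_a_D_le_outside:
  assumes "rs + \<delta> < r" and pos: "0 < afun D r"
  shows "dv_a k D r \<le> - (2 * pi * (1 + k\<^sup>2) * \<rho> r * (4 * pi * (1 - k\<^sup>2) / h * J r))"
proof -
  have r: "0 < r" using assms \<delta>_pos \<delta>_less \<Delta>_less by simp
  have ar: "0 < a r" and br: "0 < b r" using a_pos b_pos r by auto
  define c where "c = 4 * pi * (1 - k\<^sup>2) / h * J r"
  have diff: "a r - afun D r = c / (r * b r)"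
    using r br h_pos by (simp add: afun_D c_def)
  have "2 * pi * (1 + k\<^sup>2) * \<rho> r * c =
      2 * pi * (1 + k\<^sup>2) * (r * b r * (\<rho> r / a r)) * ((a r - afun D r) * a r)"
    unfolding diff using r ar br by simp
  also have "\<dots> \<le> 2 * pi * (1 + k\<^sup>2) * (r * b r * (\<rho> r / a r)) *
      ((a r - afun D r) * (a r + afun D r))"
    using r ar br rho_pos[of r] afun_D_le[of r] pos by (intro mult_left_mono) auto
  also have "(a r - afun D r) * (a r + afun D r) = - ((afun D r)\<^sup>2 - (a r)\<^sup>2)"
    by (simp add: power2_eq_square algebra_simps)
  also have "2 * pi * (1 + k\<^sup>2) * (r * b r * (\<rho> r / a r)) * \<dots> = - dv_a k D r"
    using r assms \<delta>_pos by (simp add: dv_a_D right_diff_distrib diff_divide_distrib)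
  finally show ?thesis by (simp add: c_def)
qed

text \<open>Past \<open>rs - \<delta>\<close> the integral \<open>J\<close> is positive, so
  \<open>afun D r < a r\<close> at every larger radius; on the bump the subtracted square is larger
  still.\<close>

lemma dv_a_D_neg:
  assumes "rs - \<delta> < r" and pos: "0 < afun D r"
  shows "dv_a k D r < 0"
proof -
  have r: "0 < r" using assms \<delta>_less \<Delta>_less by simp
  have ar: "0 < a r" using a_pos r by simp
  have "afun D r < a r * (1 + (if r \<in> {rs - \<delta>..rs + \<delta>} then 1 / h else 0))"
    using afun_D_less[OF assms(1)] ar h_pos by (auto intro: less_le_trans)
  then have "(afun D r)\<^sup>2 < (a r * (1 + (if r \<in> {rs - \<delta>..rs + \<delta>} then 1 / h else 0)))\<^sup>2"
    using pos by (intro power_strict_mono) auto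
  moreover have "0 < 2 * pi * (1 + k\<^sup>2) * (r * b r * (\<rho> r / a r))"
    using r ar b_pos[of r] rho_pos[of r] by (simp add: add_pos_nonneg)
  ultimately show ?thesis
    using r by (simp only: dv_a_D less_imp_le mult_pos_neg diff_less_0_iff_less)
qed

text \<open>The full bump width \<open>2 * \<delta>\<close> now enters \<open>J_ge\<close>, and
  \<open>16 = 2 * 4 * 2\<close>. One factor \<open>\<rho>\<^sub>0 / E\<close> bounds
  \<open>\<rho> r\<close>, the other comes from \<open>J\<close>.\<close>

lemma dv_a_D_le_exterior:
  assumes "rs + \<delta> < r" "r \<le> rs + \<Delta>" and pos: "0 < afun D r"
  shows "dv_a k D r \<le> - (16 * pi\<^sup>2 * (1 - k\<^sup>2) * (\<rho>\<^sub>0 / E)\<^sup>2 * (rs - \<Delta>)\<^sup>2) * (\<delta> / h)"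
proof -
  have r: "0 < r" "r \<le> 2 * rs" using assms \<delta>_pos \<delta>_less \<Delta>_less by auto
  have k: "0 \<le> 1 - k\<^sup>2" using k_pos k_less_1 by (simp add: power_le_one)
  have "2 * \<delta> * (\<rho>\<^sub>0 / E * (rs - \<Delta>)\<^sup>2) \<le> J r"
    using J_ge[of r] assms(1) \<delta>_pos by simp
  then have "2 * pi * 1 * (\<rho>\<^sub>0 / E) *
      (4 * pi * (1 - k\<^sup>2) / h * (2 * \<delta> * (\<rho>\<^sub>0 / E * (rs - \<Delta>)\<^sup>2)))
      \<le> 2 * pi * (1 + k\<^sup>2) * \<rho> r * (4 * pi * (1 - k\<^sup>2) / h * J r)"
    using r k h_pos \<delta>_pos rho0_pos growth_pos[of k \<rho>\<^sub>0 "2 * rs"] rho_ge_growth[of r] rho_pos[of r]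
    by (intro mult_mono mult_nonneg_nonneg) auto
  also note dv_a_D_le_outside[OF assms(1) pos, THEN le_imp_neg_le, unfolded minus_minus]
  also have "2 * pi * 1 * e * (4 * pi * q / h * (2 * \<delta> * (e * d))) =
      16 * pi\<^sup>2 * q * e\<^sup>2 * d * (\<delta> / h)" for q e d :: real
    by (simp add: power2_eq_square)
  finally show ?thesis by simp
qed

end

section \<open>Choice of the constants and assembly of the claims\<close>

theorem theorem2p4:
  fixes k \<rho>\<^sub>0 rs \<Delta> :: real
  assumes "0 < k" and "k < 1" and "0 < \<rho>\<^sub>0" and "0 < rs" and "0 < \<Delta>" and "\<Delta> < rs"
  shows "\<exists>C\<^sub>1>0. \<exists>C\<^sub>2>0. \<exists>C\<^sub>3>0. \<exists>C\<^sub>4>0. \<forall>\<rho> m. static_profile k \<rho>\<^sub>0 \<rho> m \<longrightarrow>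
    (let S = static_data k \<rho>\<^sub>0 \<rho> m in
      (\<forall>\<delta> h. 0 < \<delta> \<and> \<delta> < \<Delta> \<and> 0 < h \<and> \<delta> / h \<le> 1 / C\<^sub>1 \<longrightarrow>
        (let D = perturbed_data k S rs \<delta> h in
          (\<forall>r\<ge>0. 0 < afun D r \<and> afun D r \<le> afun S r) \<and>
          (\<forall>r. 0 \<le> r \<and> r < rs - \<delta> \<longrightarrow> dv_a k D r = 0) \<and>
          (\<forall>r. r > rs - \<delta> \<longrightarrow> dv_a k D r < 0) \<and>
          (\<forall>r. rs - \<delta> \<le> r \<and> r \<le> rs + \<delta> \<longrightarrow> dv_a k D r \<le> - C\<^sub>2 * (\<delta> / h ^ 3)) \<and>
          (\<forall>r. rs - \<delta> \<le> r \<and> r \<le> rs + \<delta> \<longrightarrow> dv_a k D r \<le> - C\<^sub>4 * (1 / h\<^sup>2)) \<and>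
          (\<forall>r. rs + \<delta> < r \<and> r \<le> rs + \<Delta> \<longrightarrow> dv_a k D r \<le> - C\<^sub>3 * (\<delta> / h)) \<and>
          no_trapped_surfaces D)) \<and>
      (\<forall>K>0. \<exists>\<delta> h. 0 < \<delta> \<and> \<delta> < \<Delta> \<and> 0 < h \<and> \<delta> / h \<le> 1 / C\<^sub>1 \<and>
        (\<forall>r\<in>{rs - \<delta>..rs + \<delta>}. dv_a k (perturbed_data k S rs \<delta> h) r \<le> - K)))"
proof -
  define E where "E = growth k \<rho>\<^sub>0 (2 * rs)"
  define c where "c = 864 * pi * E * \<rho>\<^sub>0 * rs\<^sup>2 / (rs - \<Delta>)"
  \<comment> \<open>The factor 2 turns the non-strict condition on \<open>\<delta> / h\<close> into
    the strict smallness required by \<open>afun_D_pos\<close>.\<close>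
  define C\<^sub>1 where "C\<^sub>1 = 2 * c"
  define C\<^sub>4 where "C\<^sub>4 = 2 / 9 * pi * (rs - \<Delta>) * (\<rho>\<^sub>0 / E)"
  \<comment> \<open>Since \<open>\<delta> / h ^ 3 \<le> 1 / C\<^sub>1 * (1 / h\<^sup>2)\<close>,
    this choice reduces the \<open>\<delta> / h ^ 3\<close> bound to the
    \<open>1 / h\<^sup>2\<close> bound.\<close>
  define C\<^sub>2 where "C\<^sub>2 = C\<^sub>4 * C\<^sub>1"
  define C\<^sub>3 where "C\<^sub>3 = 16 * pi\<^sup>2 * (1 - k\<^sup>2) * (\<rho>\<^sub>0 / E)\<^sup>2 * (rs - \<Delta>)\<^sup>2"
  have E: "0 < E" by (simp add: E_def growth_pos)
  have c: "0 < c" using assms E by (simp add: c_def)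
  then have C1: "0 < C\<^sub>1" by (simp add: C\<^sub>1_def)
  have C4: "0 < C\<^sub>4" using assms E by (simp add: C\<^sub>4_def)
  with C1 have C2: "0 < C\<^sub>2" by (simp add: C\<^sub>2_def)
  have C3: "0 < C\<^sub>3" using assms E by (simp add: C\<^sub>3_def power_less_one_iff)
  have main: "(\<forall>r\<ge>0. 0 < afun D r \<and> afun D r \<le> afun S r) \<and>
      (\<forall>r. 0 \<le> r \<and> r < rs - \<delta> \<longrightarrow> dv_a k D r = 0) \<and>
      (\<forall>r. r > rs - \<delta> \<longrightarrow> dv_a k D r < 0) \<and>
      (\<forall>r. rs - \<delta> \<le> r \<and> r \<le> rs + \<delta> \<longrightarrow> dv_a k D r \<le> - C\<^sub>2 * (\<delta> / h ^ 3)) \<and>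
      (\<forall>r. rs - \<delta> \<le> r \<and> r \<le> rs + \<delta> \<longrightarrow> dv_a k D r \<le> - C\<^sub>4 * (1 / h\<^sup>2)) \<and>
      (\<forall>r. rs + \<delta> < r \<and> r \<le> rs + \<Delta> \<longrightarrow> dv_a k D r \<le> - C\<^sub>3 * (\<delta> / h)) \<and>
      no_trapped_surfaces D"
    if profile: "static_profile k \<rho>\<^sub>0 \<rho> m" and S: "S = static_data k \<rho>\<^sub>0 \<rho> m"
      and D: "D = perturbed_data k S rs \<delta> h"
      and \<delta>h: "0 < \<delta>" "\<delta> < \<Delta>" "0 < h" "\<delta> / h \<le> 1 / C\<^sub>1" for \<rho> m S D \<delta> h
  proof -
    interpret perturbed_star k \<rho>\<^sub>0 \<rho> m rs \<Delta> \<delta> h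
      by unfold_locales (use assms profile \<delta>h in auto)
    have "\<delta> / h * c \<le> 1 / C\<^sub>1 * c" using \<delta>h c by (intro mult_right_mono) auto
    also have "\<dots> < 1" using c by (simp add: C\<^sub>1_def)
    finally have small: "\<delta> / h * c < 1" .
    have pos: "0 < afun D r" if "0 \<le> r" for r
      using afun_D_pos[OF that] small unfolding D S c_def E_def by blast
    have r_nonneg: "0 \<le> r" if "rs - \<delta> \<le> r" for r using that \<delta>h assms by linarith
    have bump: "dv_a k D r \<le> - C\<^sub>4 * (1 / h\<^sup>2)" if "rs - \<delta> \<le> r" "r \<le> rs + \<delta>" for r
      using dv_a_D_le_bump[OF that] pos[OF r_nonneg[OF that(1)]] unfolding D S C\<^sub>4_def E_def by blast
    have "\<delta> / h ^ 3 = \<delta> / h * (1 / h\<^sup>2)" by (simp add: eval_nat_numeral)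
    also have "\<dots> \<le> 1 / C\<^sub>1 * (1 / h\<^sup>2)" using \<delta>h by (intro mult_right_mono) auto
    finally have "C\<^sub>2 * (\<delta> / h ^ 3) \<le> C\<^sub>2 * (1 / C\<^sub>1 * (1 / h\<^sup>2))"
      using C2 by (intro mult_left_mono) auto
    also have "\<dots> = C\<^sub>4 * (1 / h\<^sup>2)" using C1 by (simp add: C\<^sub>2_def)
    finally have C2_le: "- C\<^sub>4 * (1 / h\<^sup>2) \<le> - C\<^sub>2 * (\<delta> / h ^ 3)" by simp
    have "afun D r \<le> afun S r" if "0 \<le> r" for r
      using afun_D_le[OF that] unfolding D S afun_S .
    moreover have "dv_a k D r = 0" if "0 \<le> r" "r < rs - \<delta>" for r
      using dv_a_D_eq_0[OF that] unfolding D S .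
    moreover have "dv_a k D r < 0" if "r > rs - \<delta>" for r
      using dv_a_D_neg[OF that] pos[of r] r_nonneg[of r] that unfolding D S by simp
    moreover have "dv_a k D r \<le> - C\<^sub>3 * (\<delta> / h)" if "rs + \<delta> < r" "r \<le> rs + \<Delta>" for r
      using dv_a_D_le_exterior[OF that] pos[of r] r_nonneg[of r] that \<delta>h
      unfolding D S C\<^sub>3_def E_def by simp
    moreover have "no_trapped_surfaces D" using pos by (simp add: no_trapped_surfaces_def)
    moreover have "dv_a k D r \<le> - C\<^sub>2 * (\<delta> / h ^ 3)" if "rs - \<delta> \<le> r" "r \<le> rs + \<delta>" for r
      using bump[OF that] C2_le by (rule order_trans)
    ultimately show ?thesis using pos bump by blast
  qed
  have large: "\<exists>\<delta> h. 0 < \<delta> \<and> \<delta> < \<Delta> \<and> 0 < h \<and> \<delta> / h \<le> 1 / C\<^sub>1 \<and>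
        (\<forall>r\<in>{rs - \<delta>..rs + \<delta>}. dv_a k (perturbed_data k S rs \<delta> h) r \<le> - K)"
    if profile: "static_profile k \<rho>\<^sub>0 \<rho> m" and S: "S = static_data k \<rho>\<^sub>0 \<rho> m" and K: "0 < K"
    for \<rho> m S K
  proof (intro exI conjI ballI)
    \<comment> \<open>Chosen so that \<open>C\<^sub>4 / h\<^sup>2 = K\<close>. Then
      \<open>\<delta>\<close> is taken small enough for the ratio condition, and
      \<open>\<Delta> / 2\<close> keeps it strictly below \<open>\<Delta>\<close>.\<close>
    define h where "h = sqrt (C\<^sub>4 / K)"
    define \<delta> where "\<delta> = min (\<Delta> / 2) (h / C\<^sub>1)"
    have h: "0 < h" using C4 K by (simp add: h_def)
    show "0 < \<delta>" "\<delta> < \<Delta>" "0 < h" using h C1 assms by (auto simp: \<delta>_def)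
    have "\<delta> \<le> h / C\<^sub>1" by (simp add: \<delta>_def)
    then show "\<delta> / h \<le> 1 / C\<^sub>1" using h C1 by (simp add: field_simps)
    fix r assume "r \<in> {rs - \<delta>..rs + \<delta>}"
    then have "dv_a k (perturbed_data k S rs \<delta> h) r \<le> - C\<^sub>4 * (1 / h\<^sup>2)"
      using main[OF profile S refl \<open>0 < \<delta>\<close> \<open>\<delta> < \<Delta>\<close> \<open>0 < h\<close> \<open>\<delta> / h \<le> 1 / C\<^sub>1\<close>] by simp
    also have "C\<^sub>4 * (1 / h\<^sup>2) = K" using C4 K by (simp add: h_def)
    then have "- C\<^sub>4 * (1 / h\<^sup>2) = - K" by simp
    finally show "dv_a k (perturbed_data k S rs \<delta> h) r \<le> - K" .
  qed
  show ?thesis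
    unfolding Let_def
    by (rule exI[of _ C\<^sub>1], rule conjI[OF C1], rule exI[of _ C\<^sub>2], rule conjI[OF C2],
        rule exI[of _ C\<^sub>3], rule conjI[OF C3], rule exI[of _ C\<^sub>4], rule conjI[OF C4],
        intro allI impI, rule conjI, intro allI impI, elim conjE, rule main[OF _ refl refl],
        assumption+, intro allI impI, rule large[OF _ refl], assumption+)
qed

end
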